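(* Let $f,g:\mathbb{R}^n\to\mathbb{R}\cup\{\infty\}$ be closed proper convex functions, let $\mathcal{X}\subseteq\mathbb{R}^n$ be a convex set, and assume that the optimal value $\tau_p^*=\inf\{f(x)\mid x\in\mathcal{X},\ g(x)\le 0\}$ of the problem of minimizing $f(x)$ over $x\in\mathcal{X}$ subject to $g(x)\le 0$ is finite. Then this problem satisfies strong duality, i.e. $\tau_p^*=\tau_d^*$, if either one of the following conditions holds: (a) the objective $f$ is coercive, i.e., $f(x)\to\infty$ as $\|x\|\to\infty$; (b) $\mathcal{X}$ is compact.
   Context: Let $p(u)=\inf_{x\in\mathcal{X}}\{f(x)\mid g(x)\le u\}$ for $u\in\mathbb{R}$ (with $\inf\emptyset=+\infty$), so that $\tau_p^*=p(0)$. The dual optimal value is $\tau_d^*:=p^{\star\star}(0)$, where $p^\star(\mu)=\sup_u\{\mu u-p(u)\}$ and $p^{\star\star}=(p^\star)^\star$ is the convex biconjugate. Equivalently, $\tau_d^*$ is the optimal value of the Lagrange dual problem $\sup_{\lambda\le 0}\inf_{x\in\mathcal{X}}\{f(x)-\lambda g(x)\}$, where the expression is taken to be $+\infty$ at points with $g(x)=+\infty$ (also for $\lambda=0$). Strong duality means $\tau_p^*=\tau_d^*$.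
   Formalization: In case (a), the set X is additionally assumed closed; for a merely convex X the claim fails, e.g. X = {x1>0} ∪ {x1=0, x2≥1} in R^2, f(x)=||x||, g(x)=x1, where the primal value is 1 and the dual value is 0. *)

theory Defs
  imports "HOL-Analysis.Analysis"
begin

text \<open>
  Extended-real-valued convex functions are described through their epigraphs, which are
  subsets of \<open>'a \<times> real\<close>; the library notions \<^const>\<open>convex_on\<close> and \<^const>\<open>epigraph\<close> cover only
  real-valued functions.
\<close>

definition epi :: "('a \<Rightarrow> ereal) \<Rightarrow> ('a \<times> real) set" where
  "epi f = {(x, t). f x \<le> ereal t}"

definition proper_fun :: "('a \<Rightarrow> ereal) \<Rightarrow> bool" where
  "proper_fun f \<longleftrightarrow> (\<forall>x. f x \<noteq> -\<infinity>) \<and> (\<exists>x. f x \<noteq> \<infinity>)"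

definition closed_proper_convex :: "('a::euclidean_space \<Rightarrow> ereal) \<Rightarrow> bool" where
  "closed_proper_convex f \<longleftrightarrow> closed (epi f) \<and> proper_fun f \<and> convex (epi f)"

text \<open>
  Coercivity is convergence to the point \<open>\<infinity>\<close> of \<^typ>\<open>ereal\<close>. The filter \<^const>\<open>at_top\<close> would be
  wrong here: as \<^typ>\<open>ereal\<close> has a greatest element, it would force \<open>f x = \<infinity>\<close> outside a bounded set.
\<close>

definition coercive :: "('a::euclidean_space \<Rightarrow> ereal) \<Rightarrow> bool" where
  "coercive f \<longleftrightarrow> (f \<longlongrightarrow> \<infinity>) at_infinity"

text \<open>
  The infimum is taken in the complete lattice \<^typ>\<open>ereal\<close>, so it is \<open>\<infinity>\<close> when no point is feasible.
\<close>

definition value_fun ::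
  "('a \<Rightarrow> ereal) \<Rightarrow> ('a \<Rightarrow> ereal) \<Rightarrow> 'a set \<Rightarrow> real \<Rightarrow> ereal" where
  "value_fun f g X u = (INF x \<in> {x \<in> X. g x \<le> ereal u}. f x)"

text \<open>
  The minuend is always finite, so the subtraction is never of the form \<open>\<infinity> - \<infinity>\<close>.
\<close>

definition conjugate :: "(real \<Rightarrow> ereal) \<Rightarrow> real \<Rightarrow> ereal" where
  "conjugate h \<mu> = (SUP u. ereal (\<mu> * u) - h u)"

definition primal_value :: "('a \<Rightarrow> ereal) \<Rightarrow> ('a \<Rightarrow> ereal) \<Rightarrow> 'a set \<Rightarrow> ereal" where
  "primal_value f g X = (INF x \<in> {x \<in> X. g x \<le> 0}. f x)"

definition dual_value :: "('a \<Rightarrow> ereal) \<Rightarrow> ('a \<Rightarrow> ereal) \<Rightarrow> 'a set \<Rightarrow> ereal" where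
  "dual_value f g X = conjugate (conjugate (value_fun f g X)) 0"

end

(*
  The set of all (u, t) with g x \<le> u and f x \<le> t for some x in X is convex, and it is closed
  because the sublevel sets of f in X are compact. For r < p(0) the point (0, r) lies outside this
  set, so a line strictly separates the two. The set contains a point (0, t) with t > r, so the line
  is not vertical; its slope is a dual multiplier whose dual value is at least r.
*)
theory Submission
  imports Defs
begin

text \<open>This set lies between the strict epigraph and the epigraph of
  \<open>value_fun f g X\<close>. Every point has an actual witness in \<open>X\<close>, so no
  attainment of the infimum is presupposed.\<close>

definition upper_image :: "('a \<Rightarrow> ereal) \<Rightarrow> ('a \<Rightarrow> ereal) \<Rightarrow> 'a set \<Rightarrow> (real \<times> real) set" where
  "upper_image f g X = {(u, t). \<exists>x\<in>X. g x \<le> ereal u \<and> f x \<le> ereal t}"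

lemma closed_sublevel:
  fixes f :: "'a::topological_space \<Rightarrow> ereal"
  assumes "closed (epi f)"
  shows "closed {x. f x \<le> ereal T}"
proof -
  have "{x. f x \<le> ereal T} = (\<lambda>x. (x, T)) -` epi f"
    by (auto simp: epi_def)
  then show ?thesis
    using assms by (auto intro!: closed_vimage continuous_intros)
qed

lemma coercive_imp_bounded_sublevel:
  assumes "coercive f"
  shows "bounded {x. f x \<le> ereal T}"
proof -
  have "\<forall>\<^sub>F x in at_infinity. ereal T < f x"
    using assms by (simp add: coercive_def tendsto_PInfty)
  then obtain b where "\<And>x. b \<le> norm x \<Longrightarrow> ereal T < f x"
    by (auto simp: eventually_at_infinity)
  then show ?thesis
    by (intro boundedI[of _ b]) (metis linorder_le_cases mem_Collect_eq not_le)
qed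

text \<open>The two alternatives of the theorem enter only through this compactness. The sublevel
  set of \<open>f\<close> is closed; boundedness comes from coercivity or from
  \<open>X\<close>.\<close>

lemma compact_sublevel:
  fixes f :: "'a::euclidean_space \<Rightarrow> ereal"
  assumes "closed (epi f)" and "(coercive f \<and> closed X) \<or> compact X"
  shows "compact {x \<in> X. f x \<le> ereal T}"
proof -
  have eq: "{x \<in> X. f x \<le> ereal T} = X \<inter> {x. f x \<le> ereal T}"
    by auto
  show ?thesis
    unfolding eq
    using assms closed_sublevel[OF assms(1), of T] coercive_imp_bounded_sublevel[of f T]
    by (auto simp: compact_eq_bounded_closed bounded_Int)
qed

text \<open>The same convex combination of two witnesses is a witness for the combined
  point.\<close>

lemma convex_upper_image:
  fixes f g :: "'a::real_vector \<Rightarrow> ereal"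
  assumes "convex (epi f)" "convex (epi g)" "convex X"
  shows "convex (upper_image f g X)"
proof (rule convexI)
  fix p q :: "real \<times> real" and a b :: real
  assume "p \<in> upper_image f g X" "q \<in> upper_image f g X" and ab: "0 \<le> a" "0 \<le> b" "a + b = 1"
  then obtain x y where x: "x \<in> X" "(x, fst p) \<in> epi g" "(x, snd p) \<in> epi f"
    and y: "y \<in> X" "(y, fst q) \<in> epi g" "(y, snd q) \<in> epi f"
    by (auto simp: upper_image_def epi_def)
  show "a *\<^sub>R p + b *\<^sub>R q \<in> upper_image f g X"
    using convexD[OF assms(3) x(1) y(1) ab] convexD[OF assms(2) x(2) y(2) ab]
      convexD[OF assms(1) x(3) y(3) ab]
    by (auto simp: upper_image_def epi_def case_prod_beta)
qed

text \<open>Witnesses for a convergent sequence have a limit point in \<open>X\<close>, and the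
  closed epigraphs carry both inequalities over to it.\<close>

lemma closed_upper_image:
  fixes f g :: "'a::metric_space \<Rightarrow> ereal"
  assumes f: "closed (epi f)" and g: "closed (epi g)"
    and compact: "\<And>T. compact {x \<in> X. f x \<le> ereal T}"
  shows "closed (upper_image f g X)"
  unfolding closed_sequential_limits
proof (intro allI impI, elim conjE)
  fix s l
  assume s: "\<forall>n. s n \<in> upper_image f g X" and lim: "s \<longlonglongrightarrow> l"
  then obtain x where x: "\<And>n. x n \<in> X" "\<And>n. (x n, fst (s n)) \<in> epi g"
      "\<And>n. (x n, snd (s n)) \<in> epi f"
    by (simp add: upper_image_def epi_def case_prod_beta) metis
  have snd_lim: "(\<lambda>n. snd (s n)) \<longlonglongrightarrow> snd l" and fst_lim: "(\<lambda>n. fst (s n)) \<longlonglongrightarrow> fst l"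
    using lim by (auto intro: tendsto_intros)
  \<comment> \<open>Convergent heights are bounded, so a single compact sublevel set contains all
    witnesses.\<close>
  then obtain T where "\<And>n. snd (s n) \<le> T"
    by (metis Bseq_def abs_le_D1 convergentI convergent_imp_Bseq real_norm_def)
  then have "x n \<in> {x \<in> X. f x \<le> ereal T}" for n
    using x(1,3)[of n] by (auto simp: epi_def intro: order_trans)
  then obtain y r where y: "y \<in> X" and r: "strict_mono (r :: nat \<Rightarrow> nat)"
    and x_lim: "(x \<circ> r) \<longlonglongrightarrow> y"
    using compact[of T] unfolding compact_def by blast
  have "(\<lambda>n. (x (r n), fst (s (r n)))) \<longlonglongrightarrow> (y, fst l)"
    using x_lim LIMSEQ_subseq_LIMSEQ[OF fst_lim r] by (auto simp: o_def intro: tendsto_Pair)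
  then have "(y, fst l) \<in> epi g"
    by (rule closed_sequentially[OF g, rotated]) (rule x(2))
  moreover have "(\<lambda>n. (x (r n), snd (s (r n)))) \<longlonglongrightarrow> (y, snd l)"
    using x_lim LIMSEQ_subseq_LIMSEQ[OF snd_lim r] by (auto simp: o_def intro: tendsto_Pair)
  then have "(y, snd l) \<in> epi f"
    by (rule closed_sequentially[OF f, rotated]) (rule x(3))
  ultimately show "l \<in> upper_image f g X"
    using y by (auto simp: upper_image_def epi_def case_prod_beta)
qed

lemma value_fun_0: "value_fun f g X 0 = primal_value f g X"
  by (simp add: value_fun_def primal_value_def zero_ereal_def)

text \<open>Here \<open>- conjugate h \<mu>\<close> is the dual function: the supremum of the
  intercepts at 0 of lines of slope \<open>\<mu>\<close> below \<open>h\<close>.\<close>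

lemma biconjugate_0: "conjugate (conjugate h) 0 = (SUP \<mu>. - conjugate h \<mu>)"
  by (simp add: conjugate_def[of "conjugate h"] flip: zero_ereal_def)

text \<open>Weak duality: the term \<open>u = 0\<close> of the conjugate does not depend on the
  slope.\<close>

lemma biconjugate_0_le: "conjugate (conjugate h) 0 \<le> h 0"
proof -
  have "- h 0 \<le> conjugate h \<mu>" for \<mu>
    unfolding conjugate_def by (rule SUP_upper2[of 0]) (auto simp flip: zero_ereal_def)
  then show ?thesis
    unfolding biconjugate_0 by (intro SUP_least) (metis ereal_minus_le_minus ereal_uminus_uminus)
qed

lemma le_biconjugate_0:
  assumes "\<And>u. ereal (r + \<mu> * u) \<le> h u"
  shows "ereal r \<le> conjugate (conjugate h) 0"
proof -
  have "ereal (\<mu> * u) - h u \<le> - ereal r" for u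
    using assms[of u] by (cases "h u") auto
  then have "conjugate h \<mu> \<le> - ereal r"
    unfolding conjugate_def by (rule SUP_least)
  then show ?thesis
    unfolding biconjugate_0
    by (intro SUP_upper2[of \<mu>]) (simp, metis ereal_minus_le_minus ereal_uminus_uminus)
qed

lemma affine_minorant_value_fun:
  fixes f g :: "'a \<Rightarrow> ereal"
  assumes convex: "convex (upper_image f g X)" and closed: "closed (upper_image f g X)"
    and proper: "\<And>x. f x \<noteq> -\<infinity>" and finite: "primal_value f g X < \<infinity>"
    and r: "ereal r < primal_value f g X"
  obtains \<mu> where "\<And>u. ereal (r + \<mu> * u) \<le> value_fun f g X u"
proof -
  \<comment> \<open>In particular \<open>(0, r)\<close> itself is outside the set, as separation
    requires.\<close>
  have below: "r < t" if "(0, t) \<in> upper_image f g X" for t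
  proof -
    from that have "primal_value f g X \<le> ereal t"
      by (auto simp: upper_image_def primal_value_def zero_ereal_def intro: INF_lower2)
    with r show ?thesis
      by (metis less_ereal.simps(1) order_less_le_trans)
  qed
  then obtain p c where p: "p \<bullet> (0, r) < c"
    and sep: "\<And>q. q \<in> upper_image f g X \<Longrightarrow> c < p \<bullet> q"
    using separating_hyperplane_closed_point[OF convex closed, of "(0, r)"] by blast
  define a b where "a = fst p" and "b = snd p"
  have br: "b * r < c"
    using p by (simp add: b_def inner_prod_def)
  have sep': "c < a * u + b * t" if "(u, t) \<in> upper_image f g X" for u t
    using sep[OF that] by (simp add: a_def b_def inner_prod_def)
  \<comment> \<open>A feasible point of finite cost yields a point of the set straight above
    \<open>(0, r)\<close>, which forces \<open>b\<close> to be positive.\<close>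
  obtain x where x: "x \<in> X" "g x \<le> 0" "f x < \<infinity>"
    using finite unfolding primal_value_def INF_less_iff by blast
  then obtain t where "f x = ereal t"
    using proper[of x] by (cases "f x") auto
  with x have "(0, t) \<in> upper_image f g X"
    by (auto simp: upper_image_def zero_ereal_def)
  with sep'[of 0 t] below[of t] br have "b * r < b * t" "r < t"
    by auto
  then have b: "0 < b"
    by (smt (verit) mult_left_mono_neg)
  \<comment> \<open>Solving \<open>b * r < a * u + b * t\<close> for \<open>t\<close> gives the
    slope \<open>- a / b\<close>; the separating line is lowered in parallel until it passes through
    \<open>(0, r)\<close>.\<close>
  have "ereal (r + (- a / b) * u) \<le> value_fun f g X u" for u
    unfolding value_fun_def
  proof (rule INF_greatest)
    fix y assume y: "y \<in> {x \<in> X. g x \<le> ereal u}"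
    show "ereal (r + (- a / b) * u) \<le> f y"
    proof (cases "f y")
      case (real t)
      with y have "(u, t) \<in> upper_image f g X"
        by (auto simp: upper_image_def)
      from sep'[OF this] br have "b * r < a * u + b * t"
        by simp
      with b real show ?thesis
        by (simp add: field_simps)
    qed (use proper in auto)
  qed
  then show ?thesis
    by (rule that)
qed

text \<open>Coercivity without closedness of \<open>X\<close> would not suffice. In the plane let
  \<open>X\<close> consist of the points with x > 0 and those with x = 0, y \<ge> 1, let f(x, y) =
  |x| + |y| and g(x, y) = x: the primal value is 1, the dual value 0.\<close>

theorem proposition6p1:
  fixes f g :: "real ^ 'n \<Rightarrow> ereal"
    and X :: "(real ^ 'n) set"
  assumes "closed_proper_convex f"
    and "closed_proper_convex g"
    and "convex X"
    and "\<bar>primal_value f g X\<bar> \<noteq> \<infinity>"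
    and "(coercive f \<and> closed X) \<or> compact X"
  shows "primal_value f g X = dual_value f g X"
proof (rule antisym)
  show "dual_value f g X \<le> primal_value f g X"
    using biconjugate_0_le[of "value_fun f g X"] by (simp add: dual_value_def value_fun_0)
  have convex: "convex (upper_image f g X)"
    using assms by (auto simp: closed_proper_convex_def intro: convex_upper_image)
  have closed: "closed (upper_image f g X)"
    using assms by (auto simp: closed_proper_convex_def intro!: closed_upper_image compact_sublevel)
  show "primal_value f g X \<le> dual_value f g X"
  \<comment> \<open>Strict separation needs a point strictly below the primal value, so that value
    is approached from below.\<close>
  proof (rule dense_le)
    fix s assume s: "s < primal_value f g X"
    show "s \<le> dual_value f g X"
    proof (cases s)
      case (real r)
      have "\<And>x. f x \<noteq> -\<infinity>" "primal_value f g X < \<infinity>" "ereal r < primal_value f g X"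
        using assms(1,4) s real by (auto simp: closed_proper_convex_def proper_fun_def)
      then obtain \<mu> where "\<And>u. ereal (r + \<mu> * u) \<le> value_fun f g X u"
        using affine_minorant_value_fun[OF convex closed] by blast
      then show ?thesis
        unfolding dual_value_def real by (rule le_biconjugate_0)
    qed (use s in auto)
  qed
qed

end
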